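(* If $b \in \{2, 3, 5, 7, 9\}$, then there are infinitely many triangular numbers which are palindromic in base $b$.
   Context: Triangular numbers are $t_n = \frac{n(n+1)}{2}$ for positive integers $n$. A positive integer $k$ with base-$b$ expansion $k = \sum_{i=0}^m a_i b^i$ ($0\le a_i\le b-1$, $a_m\neq 0$) is palindromic in base $b$ if $a_i = a_{m-i}$ for all $i = 0, 1, \dots, m$. *)

theory Defs
  imports Complex_Main "HOL-Library.Nat_Bijection"
begin

text \<open>
  Triangular numbers are the values of \<^const>\<open>triangle\<close> from \<^theory>\<open>HOL-Library.Nat_Bijection\<close>,
  with \<^prop>\<open>triangle n = (n * Suc n) div 2\<close>.

  For \<open>b \<ge> 2\<close> the base-\<open>b\<close> expansion of a positive integer is unique, so the existential
  quantifier over \<open>m\<close> and \<open>a\<close> selects the digits of \<open>k\<close>; values \<open>a i\<close> with \<open>i > m\<close> are irrelevant.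
\<close>

definition palindromic_in_base :: "nat \<Rightarrow> nat \<Rightarrow> bool" where
  "palindromic_in_base b k \<longleftrightarrow>
     0 < k \<and>
     (\<exists>(m::nat) (a::nat \<Rightarrow> nat).
        k = (\<Sum>i=0..m. a i * b ^ i) \<and>
        (\<forall>i\<le>m. a i \<le> b - 1) \<and>
        a m \<noteq> 0 \<and>
        (\<forall>i\<le>m. a i = a (m - i)))"

end

theory Submission
  imports Defs "HOL-Library.Infinite_Set"
begin

text \<open>
  For odd \<open>q\<close> the index \<open>n = (q^(k+1) - 1) / 2\<close> satisfies \<open>8 t\<^sub>n + 1 = (2 n + 1)\<^sup>2 = q^(2k+2)\<close>, so that
  \<open>t\<^sub>n = d (1 + q\<^sup>2 + \<dots> + q^(2k))\<close> with \<open>d = (q\<^sup>2 - 1) / 8\<close>. For \<open>q = 3, 5, 7\<close> the number \<open>d = 1, 3, 6\<close>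
  is a single digit in base \<open>q\<close>, and the expansion is \<open>d0d0\<dots>0d\<close>; the case \<open>q = 3\<close>
  read in base 9 is the repunit \<open>11\<dots>1\<close>. In base 2 the index \<open>n = 2^(j+1) + 1\<close> gives
  \<open>t\<^sub>n = 2^(2j+1) + 2^(j+1) + 2^j + 1\<close>.
\<close>

lemma eight_triangle: "8 * triangle n + 1 = (2 * n + 1)\<^sup>2"
  by (induction n) (simp_all add: power2_eq_square)

lemma triangle_ge: "n \<le> triangle n"
  by (induction n) simp_all

lemma infinite_palindromic_trianglesI:
  assumes "\<And>k. \<exists>n>k. palindromic_in_base b (triangle n)"
  shows "infinite {t. (\<exists>n\<ge>1. t = triangle n) \<and> palindromic_in_base b t}"
  unfolding infinite_nat_iff_unbounded
proof
  fix k
  obtain n where n: "n > k" "palindromic_in_base b (triangle n)"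
    using assms by blast
  then have "k < triangle n" "1 \<le> n"
    using triangle_ge[of n] by linarith+
  with n show "\<exists>t>k. t \<in> {t. (\<exists>n\<ge>1. t = triangle n) \<and> palindromic_in_base b t}"
    by blast
qed

lemma triangle_eq_geometric_sum:
  assumes "8 * d + 1 = q\<^sup>2" and "2 * n + 1 = q ^ Suc k"
  shows "triangle n = d * (\<Sum>i=0..k. (q\<^sup>2) ^ i)"
proof -
  \<comment> \<open>The factor \<open>8 * d\<close> is the ratio minus one, so the geometric sum
    telescopes without subtraction or division.\<close>
  have "8 * (d * (\<Sum>i=0..k. (8 * d + 1) ^ i)) + 1 = (8 * d + 1) ^ Suc k"
    by (induction k) (simp_all add: algebra_simps)
  also have "\<dots> = 8 * triangle n + 1"
    unfolding eight_triangle assms by (simp only: power_mult [symmetric] mult.commute)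
  finally show ?thesis
    by (simp add: assms(1) [simplified])
qed

lemma ex_triangle_eq_geometric_sum:
  assumes "8 * d + 1 = q\<^sup>2" and "0 < d"
  shows "\<exists>n>k. triangle n = d * (\<Sum>i=0..Suc k. (q\<^sup>2) ^ i)"
proof -
  have "odd (q\<^sup>2)"
    unfolding assms(1) [symmetric] by simp
  then have "odd q" by simp
  then have "odd (q ^ Suc (Suc k))" by simp
  then obtain n where n: "q ^ Suc (Suc k) = 2 * n + 1" by (elim oddE)
  \<comment> \<open>The bound \<open>3 \<le> q\<close> makes \<open>2 * n + 1\<close> grow at least
    like a power of 3, which pushes \<open>n\<close> past \<open>k\<close>.\<close>
  have "3\<^sup>2 \<le> q\<^sup>2"
    unfolding assms(1) [symmetric] using assms(2) by simp
  then have "3 \<le> q"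
    by (rule power2_le_imp_le) simp
  then have "3 ^ Suc (Suc k) \<le> 2 * n + 1"
    unfolding n [symmetric] by (rule power_mono) simp
  moreover have "2 * k + 3 < (3::nat) ^ Suc (Suc k)"
    by (induction k) simp_all
  ultimately have "k < n" by linarith
  with triangle_eq_geometric_sum[OF assms(1) n [symmetric]] show ?thesis by blast
qed

lemma palindromic_repdigit:
  assumes "0 < d" "d < b"
  shows "palindromic_in_base b (d * (\<Sum>i=0..k. b ^ i))"
  unfolding palindromic_in_base_def
proof (intro conjI exI)
  show "0 < d * (\<Sum>i=0..k. b ^ i)"
    using assms by (auto intro: sum_pos)
  show "d * (\<Sum>i=0..k. b ^ i) = (\<Sum>i=0..k. (\<lambda>_. d) i * b ^ i)"
    by (simp add: sum_distrib_left)
qed (use assms in auto)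

lemma palindromic_spaced_repdigit:
  assumes "0 < d" "d < b"
  shows "palindromic_in_base b (d * (\<Sum>i=0..k. (b\<^sup>2) ^ i))"
  unfolding palindromic_in_base_def
proof (intro conjI exI)
  \<comment> \<open>The top position \<open>2 * k\<close> is even, so the leading digit is
    \<open>d\<close> and reflection preserves parity.\<close>
  let ?a = "\<lambda>i::nat. if even i then d else 0"
  show "0 < d * (\<Sum>i=0..k. (b\<^sup>2) ^ i)"
    using assms by (auto intro: sum_pos)
  show "d * (\<Sum>i=0..k. (b\<^sup>2) ^ i) = (\<Sum>i=0..2 * k. ?a i * b ^ i)"
    by (induction k) (simp_all add: distrib_left power2_eq_square power_mult power_mult_distrib mult_ac)
qed (use assms in auto)

lemma palindromic_binary:
  assumes "0 < j"
  shows "palindromic_in_base 2 (2 ^ (2 * j + 1) + 2 ^ (j + 1) + 2 ^ j + 1)"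
  unfolding palindromic_in_base_def
proof (intro conjI exI)
  \<comment> \<open>The positions of the ones: reflection swaps the outer pair and the inner pair,
    and \<open>0 < j\<close> keeps all four distinct.\<close>
  let ?S = "{0, j, j + 1, 2 * j + 1}"
  let ?a = "\<lambda>i. if i \<in> ?S then 1 else 0 :: nat"
  have "(\<Sum>i=0..2 * j + 1. ?a i * 2 ^ i) = (\<Sum>i\<in>?S. ?a i * 2 ^ i)"
    by (rule sum.mono_neutral_right) auto
  also have "\<dots> = 2 ^ (2 * j + 1) + 2 ^ (j + 1) + 2 ^ j + 1"
    using assms by simp
  finally show "2 ^ (2 * j + 1) + 2 ^ (j + 1) + 2 ^ j + 1 = (\<Sum>i=0..2 * j + 1. ?a i * 2 ^ i)" ..
  show "\<forall>i\<le>2 * j + 1. ?a i = ?a (2 * j + 1 - i)"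
    by auto
qed auto

lemma triangle_binary:
  "triangle (2 ^ (j + 1) + 1) = 2 ^ (2 * j + 1) + 2 ^ (j + 1) + 2 ^ j + 1"
proof -
  have "(2::nat) ^ (2 * j + 1) = 2 * (2 ^ j * 2 ^ j)"
    by (simp flip: power_add mult_2)
  then have "8 * triangle (2 ^ (j + 1) + 1) + 1
      = 8 * (2 ^ (2 * j + 1) + 2 ^ (j + 1) + 2 ^ j + 1) + (1::nat)"
    unfolding eight_triangle
    by (simp add: power2_eq_square algebra_simps)
  then show ?thesis by (simp only: add_right_cancel mult_cancel1) simp
qed

theorem theorem3p2:
  fixes b :: nat
  assumes "b \<in> {2, 3, 5, 7, 9}"
  shows "infinite {t. (\<exists>n\<ge>1. t = triangle n) \<and> palindromic_in_base b t}"
proof (rule infinite_palindromic_trianglesI)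
  fix k
  have spaced: "\<exists>n>k. palindromic_in_base q (triangle n)"
    if "8 * d + 1 = q\<^sup>2" "0 < d" "d < q" for d q
    using ex_triangle_eq_geometric_sum[of d q k] palindromic_spaced_repdigit[of d q "Suc k"] that
    by metis
  consider "b = 2" | "b = 3" | "b = 5" | "b = 7" | "b = 9"
    using assms by blast
  then show "\<exists>n>k. palindromic_in_base b (triangle n)"
  proof cases
    case 1
    \<comment> \<open>Taking \<open>j = Suc k\<close> ensures \<open>0 < j\<close> even for
      \<open>k = 0\<close>.\<close>
    have "palindromic_in_base b (triangle (2 ^ (Suc k + 1) + 1))"
      unfolding 1 triangle_binary by (rule palindromic_binary) simp
    moreover have "k < 2 ^ (Suc k + 1) + 1"
      using less_exp[of "Suc k + 1"] by linarith
    ultimately show ?thesis by blast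
  next
    case 2
    then show ?thesis using spaced[of 1 3] by simp
  next
    case 3
    then show ?thesis using spaced[of 3 5] by simp
  next
    case 4
    then show ?thesis using spaced[of 6 7] by simp
  next
    case 5
    then show ?thesis
      using ex_triangle_eq_geometric_sum[of 1 3 k] palindromic_repdigit[of 1 9 "Suc k"] by auto
  qed
qed

end
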